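(* Let $f_1\in\mathcal F_{\mu_1,L_1}$ and $f_2\in\mathcal F_{\mu_2,L_2}$ be functions on $\mathbb R^d$ satisfying the standing assumption (A) of the context, with $\mu_1>-\mu_2>0$ and $\mu_2\in\big(-\mu_1,\frac{-L_2\mu_1}{L_2+\mu_1}\big]$, and let $F=f_1-f_2$. Consider two DCA iterations connecting $x^k$, $x^{k+1}$ and $x^{k+2}$ (with $x^k\in\operatorname{dom}\partial f_1$). Then $$F(x^k)-F(x^{k+1})\;\ge\;\frac{\mu_1^2(\mu_1+\mu_2)}{\mu_2^2}\,\frac12\|x^{k+1}-x^{k+2}\|^2 .$$
   Context: Function class. For $\mu\in\mathbb R$ and $L\in(\mu,\infty]$, $\mathcal F_{\mu,L}$ denotes the set of proper, lower semicontinuous functions $f:\mathbb R^d\to\mathbb R\cup\{+\infty\}$ such that $f-\frac{\mu}{2}\|\cdot\|^2$ is convex and, if $L<\infty$, $f$ is finite-valued and $\frac L2\|\cdot\|^2-f$ is convex (no condition on the upper curvature if $L=\infty$). Expressions in which some $L_i=\infty$ are understood as limits $L_i\to\infty$. Subdifferential. For convex $f$, $\partial f(x)$ is the usual convex subdifferential. For $f\in\mathcal F_{\mu,L}$ with $\mu<0$, $\partial f(x):=\partial\tilde f(x)+\mu x$ where $\tilde f=f-\frac\mu2\|\cdot\|^2$ is convex. $\operatorname{dom}\partial f=\{x:\partial f(x)\ne\emptyset\}$ and $\operatorname{range}\partial f=\bigcup_x\partial f(x)$. Standing assumption (A). $f_1\in\mathcal F_{\mu_1,L_1}$ and $f_2\in\mathcal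 F_{\mu_2,L_2}$ with $0\le\mu_1<L_1\le\infty$, $\mu_2\in(-\infty,\infty)$, $L_2\in(\mu_2,\infty]$; $F=f_1-f_2$ (with the convention $(+\infty)-(+\infty)=+\infty$) is bounded below; $\emptyset\ne\operatorname{dom}\partial f_1\subseteq\operatorname{dom}\partial f_2$ and $\operatorname{range}\partial f_2\subseteq\operatorname{range}\partial f_1$. DCA (difference-of-convex algorithm). Given $x^k$, one iteration selects any $g_2^k\in\partial f_2(x^k)$ and any $x^{k+1}\in\arg\min_{w\in\mathbb R^d}\{f_1(w)-\langle g_2^k,w\rangle\}$. *)

theory Defs
  imports "HOL-Analysis.Analysis"
begin

text \<open>Functions into \<open>\<real> \<union> {+\<infinity>}\<close> are modelled as \<open>ereal\<close>-valued functions;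
  the value \<open>-\<infinity>\<close> is excluded by properness.\<close>

definition proper :: "('a \<Rightarrow> ereal) \<Rightarrow> bool" where
  "proper f \<longleftrightarrow> (\<forall>x. f x \<noteq> -\<infinity>) \<and> (\<exists>x. f x \<noteq> \<infinity>)"

definition lower_semicont :: "('a::topological_space \<Rightarrow> ereal) \<Rightarrow> bool" where
  "lower_semicont f \<longleftrightarrow> (\<forall>x. f x \<le> Liminf (at x) f)"

text \<open>Meaningful for functions that never take the value \<open>-\<infinity>\<close>.\<close>

definition econvex :: "('a::real_vector \<Rightarrow> ereal) \<Rightarrow> bool" where
  "econvex f \<longleftrightarrow> (\<forall>x y. \<forall>u>0. \<forall>v>0. u + v = 1 \<longrightarrow>
     f (u *\<^sub>R x + v *\<^sub>R y) \<le> ereal u * f x + ereal v * f y)"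

definition minus_quad :: "real \<Rightarrow> ('a::real_normed_vector \<Rightarrow> ereal) \<Rightarrow> 'a \<Rightarrow> ereal" where
  "minus_quad \<mu> f x = f x - ereal (\<mu> / 2 * (norm x)\<^sup>2)"

definition curv_class :: "real \<Rightarrow> ereal \<Rightarrow> ('a::euclidean_space \<Rightarrow> ereal) set" where
  "curv_class \<mu> L = {f. proper f \<and> lower_semicont f \<and> econvex (minus_quad \<mu> f) \<and>
     (L < \<infinity> \<longrightarrow> (\<forall>x. f x < \<infinity>) \<and>
        convex_on UNIV (\<lambda>x. real_of_ereal L / 2 * (norm x)\<^sup>2 - real_of_ereal (f x)))}"

definition convex_subdiff :: "('a::real_inner \<Rightarrow> ereal) \<Rightarrow> 'a \<Rightarrow> 'a set" where
  "convex_subdiff f x = {g. f x < \<infinity> \<and> (\<forall>y. f y \<ge> f x + ereal (inner g (y - x)))}"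

text \<open>The parameter \<open>\<mu>\<close> is the lower curvature of the class that \<open>f\<close> is taken from.\<close>

definition subdiff :: "real \<Rightarrow> ('a::real_inner \<Rightarrow> ereal) \<Rightarrow> 'a \<Rightarrow> 'a set" where
  "subdiff \<mu> f x =
     (if \<mu> < 0 then (\<lambda>g. g + \<mu> *\<^sub>R x) ` convex_subdiff (minus_quad \<mu> f) x
      else convex_subdiff f x)"

definition dom_subdiff :: "real \<Rightarrow> ('a::real_inner \<Rightarrow> ereal) \<Rightarrow> 'a set" where
  "dom_subdiff \<mu> f = {x. subdiff \<mu> f x \<noteq> {}}"

definition range_subdiff :: "real \<Rightarrow> ('a::real_inner \<Rightarrow> ereal) \<Rightarrow> 'a set" where
  "range_subdiff \<mu> f = (\<Union>x. subdiff \<mu> f x)"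

text \<open>The required convention \<open>(+\<infinity>) - (+\<infinity>) = +\<infinity>\<close> is the one built into \<open>ereal\<close>
  subtraction.\<close>

definition dc_objective :: "('a \<Rightarrow> ereal) \<Rightarrow> ('a \<Rightarrow> ereal) \<Rightarrow> 'a \<Rightarrow> ereal" where
  "dc_objective f1 f2 x = f1 x - f2 x"

lemma "(\<infinity>::ereal) - \<infinity> = \<infinity>"
  by simp

definition dc_assumption ::
  "real \<Rightarrow> ereal \<Rightarrow> real \<Rightarrow> ereal \<Rightarrow> ('a::euclidean_space \<Rightarrow> ereal) \<Rightarrow> ('a \<Rightarrow> ereal) \<Rightarrow> bool" where
  "dc_assumption \<mu>1 L1 \<mu>2 L2 f1 f2 \<longleftrightarrow>
     f1 \<in> curv_class \<mu>1 L1 \<and> f2 \<in> curv_class \<mu>2 L2 \<and>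
     0 \<le> \<mu>1 \<and> ereal \<mu>1 < L1 \<and> ereal \<mu>2 < L2 \<and>
     (\<exists>c::real. \<forall>x. ereal c \<le> dc_objective f1 f2 x) \<and>
     dom_subdiff \<mu>1 f1 \<noteq> {} \<and> dom_subdiff \<mu>1 f1 \<subseteq> dom_subdiff \<mu>2 f2 \<and>
     range_subdiff \<mu>2 f2 \<subseteq> range_subdiff \<mu>1 f1"

definition dca_step ::
  "real \<Rightarrow> ('a::real_inner \<Rightarrow> ereal) \<Rightarrow> ('a \<Rightarrow> ereal) \<Rightarrow> 'a \<Rightarrow> 'a \<Rightarrow> bool" where
  "dca_step \<mu>2 f1 f2 x x' \<longleftrightarrow>
     (\<exists>g \<in> subdiff \<mu>2 f2 x. is_arg_min (\<lambda>w. f1 w - ereal (inner g w)) (\<lambda>_. True) x')"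

text \<open>The quantity \<open>-L2 \<mu>1 / (L2 + \<mu>1)\<close>; its value at \<open>L2 = \<infinity>\<close> is the limit as
  \<open>L2 \<rightarrow> \<infinity>\<close>.\<close>

definition mu2_upper :: "real \<Rightarrow> ereal \<Rightarrow> real" where
  "mu2_upper \<mu>1 L2 =
     (if L2 = \<infinity> then - \<mu>1 else - real_of_ereal L2 * \<mu>1 / (real_of_ereal L2 + \<mu>1))"

end

theory Submission
  imports Defs
begin

text \<open>
  Write \<open>d = x0 - x1\<close>, \<open>D = g0 - g1\<close>, where \<open>g0 \<in> \<partial>f2(x0) \<inter> \<partial>f1(x1)\<close> and
  \<open>g1 \<in> \<partial>f2(x1) \<inter> \<partial>f1(x2)\<close>, and \<open>T = D - \<mu>2 d\<close>. Strong convexity of \<open>f1\<close> and cocoercivity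
  of the gradient of the smooth convex function \<open>f2 - \<mu>2/2 \<bar>\<cdot>\<bar>\<^sup>2\<close> give
  \<open>F(x0) - F(x1) \<ge> (\<mu>1 + \<mu>2)/2 \<bar>d\<bar>\<^sup>2 + \<bar>T\<bar>\<^sup>2/(2K)\<close> with \<open>K = L2 - \<mu>2\<close>, as well as
  \<open>\<langle>T, d\<rangle> \<ge> \<bar>T\<bar>\<^sup>2/K\<close>. Adding the second inequality with multiplier \<open>(\<mu>1 + \<mu>2)/(-\<mu>2)\<close> and using the
  upper bound on \<open>K\<close> equivalent to that on \<open>\<mu>2\<close> completes the square to
  \<open>(\<mu>1 + \<mu>2)/(2 \<mu>2\<^sup>2) \<bar>D\<bar>\<^sup>2\<close>, and \<open>\<bar>D\<bar> \<ge> \<mu>1 \<bar>x1 - x2\<bar>\<close> by strong monotonicity of \<open>\<partial>f1\<close>.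
\<close>

lemma le_of_forall_le_add_mult:
  fixes a b c :: real
  assumes "\<And>t. 0 < t \<Longrightarrow> t < 1 \<Longrightarrow> a \<le> b + t * c"
  shows "a \<le> b"
proof (rule tendsto_lowerbound)
  show "((\<lambda>t. b + t * c) \<longlongrightarrow> b) (at_right 0)"
    by (auto intro!: tendsto_eq_intros)
  show "eventually (\<lambda>t. a \<le> b + t * c) (at_right 0)"
    using assms by (auto simp: eventually_at_right_field intro!: exI[of _ 1])
qed simp

text \<open>Descent lemma without differentiability: convexity of \<open>q\<close> along the line
  through \<open>y\<close> and \<open>z\<close> leaves an error of order \<open>t\<close> after
  division by \<open>t\<close>, removed by letting \<open>t\<close> tend to 0.\<close>

lemma smooth_upper_bound:
  fixes h :: "'a::real_inner \<Rightarrow> real"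
  assumes smooth: "convex_on UNIV (\<lambda>x. K / 2 * (norm x)\<^sup>2 - h x)"
    and subgrad: "\<And>z. h z \<ge> h y + inner g (z - y)"
  shows "h z \<le> h y + inner g (z - y) + K / 2 * (norm (z - y))\<^sup>2"
proof -
  define v where "v = z - y"
  have z: "z = y + v" by (simp add: v_def)
  define q where "q = (\<lambda>x. K / 2 * (norm x)\<^sup>2 - h x)"
  have "h (y + v) \<le> h y + inner g v + K / 2 * (norm v)\<^sup>2 + t * (K / 2 * (norm v)\<^sup>2)"
    if t: "0 < t" "t < 1" for t
  proof -
    \<comment> \<open>The subgradient bounds \<open>q\<close> from above only, so \<open>y\<close> is compared with a point behind it.\<close>
    have "y = (1 / (1 + t)) *\<^sub>R (y - t *\<^sub>R v) + (t / (1 + t)) *\<^sub>R (y + v)"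
    proof -
      have "(1 / (1 + t)) *\<^sub>R (y - t *\<^sub>R v) + (t / (1 + t)) *\<^sub>R (y + v)
          = (1 / (1 + t) + t / (1 + t)) *\<^sub>R y"
        by (simp add: algebra_simps)
      also have "1 / (1 + t) + t / (1 + t) = 1"
        using t by (simp add: add_divide_distrib[symmetric])
      finally show ?thesis by simp
    qed
    moreover have "q ((1 / (1 + t)) *\<^sub>R (y - t *\<^sub>R v) + (t / (1 + t)) *\<^sub>R (y + v))
        \<le> 1 / (1 + t) * q (y - t *\<^sub>R v) + t / (1 + t) * q (y + v)"
    proof -
      have "1 / (1 + t) + t / (1 + t) = 1" "0 \<le> 1 / (1 + t)" "0 \<le> t / (1 + t)"
        using t by (simp_all add: add_divide_distrib[symmetric])
      then show ?thesis
        using smooth unfolding q_def[symmetric] convex_on_def by blast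
    qed
    ultimately have "q y \<le> (q (y - t *\<^sub>R v) + t * q (y + v)) / (1 + t)"
      by (simp add: add_divide_distrib)
    then have "(1 + t) * q y \<le> q (y - t *\<^sub>R v) + t * q (y + v)"
      using t by (simp add: pos_le_divide_eq mult.commute)
    moreover have "q (y - t *\<^sub>R v) \<le> q y + t * (inner g v - K * inner y v + t * (K / 2 * (norm v)\<^sup>2))"
      using subgrad[of "y - t *\<^sub>R v"] unfolding q_def power2_norm_eq_inner
      by (simp add: algebra_simps inner_commute power2_eq_square)
    ultimately have "t * q y \<le> t * (q (y + v) + inner g v - K * inner y v + t * (K / 2 * (norm v)\<^sup>2))"
      by (simp add: algebra_simps)
    then have "q y \<le> q (y + v) + inner g v - K * inner y v + t * (K / 2 * (norm v)\<^sup>2)"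
      using t by simp
    then show ?thesis
      unfolding q_def power2_norm_eq_inner by (simp add: algebra_simps inner_commute)
  qed
  from le_of_forall_le_add_mult[OF this] show ?thesis
    by (simp add: z)
qed

text \<open>The affine minorant of \<open>h\<close> at \<open>x\<close> lies below the quadratic
  majorant at \<open>y\<close>; where the two are closest, this yields the extra quadratic
  term.\<close>

lemma cocoercive_lower_bound:
  fixes h :: "'a::real_inner \<Rightarrow> real"
  assumes K: "K > 0"
    and smooth: "convex_on UNIV (\<lambda>x. K / 2 * (norm x)\<^sup>2 - h x)"
    and subgrad_x: "\<And>z. h z \<ge> h x + inner gx (z - x)"
    and subgrad_y: "\<And>z. h z \<ge> h y + inner gy (z - y)"
  shows "h y \<ge> h x + inner gx (y - x) + (norm (gx - gy))\<^sup>2 / (2 * K)"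
proof -
  \<comment> \<open>The minimiser over \<open>z\<close> of the gap between the upper bound at \<open>y\<close> and the affine minorant at \<open>x\<close>.\<close>
  define z where "z = y + (1 / K) *\<^sub>R (gx - gy)"
  have "h x + inner gx (z - x) \<le> h y + inner gy (z - y) + K / 2 * (norm (z - y))\<^sup>2"
    using subgrad_x[of z] smooth_upper_bound[OF smooth subgrad_y, of z] by linarith
  moreover have "inner gx (z - x) = inner gx (y - x) + inner gx (z - y)"
    by (simp add: algebra_simps)
  moreover have "inner gx (z - y) - inner gy (z - y) = (norm (gx - gy))\<^sup>2 / K"
    unfolding inner_diff_left[symmetric] by (simp add: z_def power2_norm_eq_inner)
  moreover have "norm (z - y) = norm (gx - gy) / K"
    using K by (simp add: z_def)
  then have "K / 2 * (norm (z - y))\<^sup>2 = (norm (gx - gy))\<^sup>2 / (2 * K)"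
    using K by (simp add: power2_eq_square)
  moreover have "(norm (gx - gy))\<^sup>2 / K = 2 * ((norm (gx - gy))\<^sup>2 / (2 * K))"
    by simp
  ultimately show ?thesis by linarith
qed

text \<open>On the segment from \<open>x\<close> to \<open>y\<close>, convexity bounds
  \<open>f z\<close> above and the subgradient bounds it below; divide by \<open>t\<close> and let
  \<open>t\<close> tend to 0. Finiteness of \<open>f y\<close> gives \<open>real_of_ereal\<close>
  its intended value.\<close>

lemma strong_convexity_lower_bound:
  fixes f :: "'a::real_inner \<Rightarrow> ereal"
  assumes proper: "proper f" and conv: "econvex (minus_quad \<mu> f)"
    and g: "g \<in> convex_subdiff f x" and fin: "f y < \<infinity>"
  shows "real_of_ereal (f y) \<ge> real_of_ereal (f x) + inner g (y - x) + \<mu> / 2 * (norm (y - x))\<^sup>2"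
proof -
  obtain a where a: "f x = ereal a"
    using g proper unfolding convex_subdiff_def proper_def by (cases "f x") auto
  obtain b where b: "f y = ereal b"
    using fin proper unfolding proper_def by (cases "f y") auto
  have "a + inner g (y - x) + \<mu> / 2 * (norm (y - x))\<^sup>2 \<le> b + t * (\<mu> / 2 * (norm (y - x))\<^sup>2)"
    if t: "0 < t" "t < 1" for t
  proof -
    define z where "z = (1 - t) *\<^sub>R x + t *\<^sub>R y"
    have "minus_quad \<mu> f z \<le> ereal (1 - t) * minus_quad \<mu> f x + ereal t * minus_quad \<mu> f y"
      using conv t unfolding econvex_def z_def by auto
    moreover have low: "f z \<ge> ereal (a + inner g (z - x))"
      using g a unfolding convex_subdiff_def by auto
    \<comment> \<open>Convexity excludes the value \<infinity> at \<open>z\<close>, the affine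
      minorant excludes -\<infinity>.\<close>
    ultimately obtain c where c: "f z = ereal c"
      and cv: "c - \<mu> / 2 * (norm z)\<^sup>2
        \<le> (1 - t) * (a - \<mu> / 2 * (norm x)\<^sup>2) + t * (b - \<mu> / 2 * (norm y)\<^sup>2)"
      by (cases "f z") (auto simp: minus_quad_def a b)
    have "(norm z)\<^sup>2 = (1 - t) * (norm x)\<^sup>2 + t * (norm y)\<^sup>2 - t * (1 - t) * (norm (y - x))\<^sup>2"
      unfolding z_def power2_norm_eq_inner by (simp add: algebra_simps inner_commute)
    then have "\<mu> / 2 * (t * (1 - t) * (norm (y - x))\<^sup>2)
        = \<mu> / 2 * ((1 - t) * (norm x)\<^sup>2 + t * (norm y)\<^sup>2 - (norm z)\<^sup>2)"
      by simp
    then have "c \<le> (1 - t) * a + t * b - \<mu> / 2 * (t * (1 - t) * (norm (y - x))\<^sup>2)"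
      using cv by (simp add: algebra_simps diff_divide_distrib)
    moreover have "z - x = t *\<^sub>R (y - x)"
      by (simp add: z_def algebra_simps)
    then have "c \<ge> a + t * inner g (y - x)"
      using low c by simp
    ultimately have "t * (a + inner g (y - x) + \<mu> / 2 * (norm (y - x))\<^sup>2)
        \<le> t * (b + t * (\<mu> / 2 * (norm (y - x))\<^sup>2))"
      by (simp add: algebra_simps)
    then show ?thesis using t by simp
  qed
  from le_of_forall_le_add_mult[OF this] show ?thesis
    by (simp add: a b)
qed

text \<open>Add the strong convexity bounds at \<open>x\<close> and \<open>y\<close>, apply
  Cauchy-Schwarz and cancel one factor \<open>norm (x - y)\<close>.\<close>

lemma strong_monotonicity_norm:
  fixes f :: "'a::real_inner \<Rightarrow> ereal"
  assumes proper: "proper f" and conv: "econvex (minus_quad \<mu> f)"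
    and gx: "gx \<in> convex_subdiff f x" and gy: "gy \<in> convex_subdiff f y"
  shows "\<mu> * norm (x - y) \<le> norm (gx - gy)"
proof (cases "x = y")
  case False
  have "\<mu> * (norm (x - y))\<^sup>2 \<le> inner (gx - gy) (x - y)"
    using strong_convexity_lower_bound[OF proper conv gx, of y]
      strong_convexity_lower_bound[OF proper conv gy, of x] gx gy
    by (simp add: convex_subdiff_def norm_minus_commute algebra_simps)
  also have "\<dots> \<le> norm (gx - gy) * norm (x - y)"
    by (rule norm_cauchy_schwarz)
  finally show ?thesis
    using False by (simp add: power2_eq_square mult.assoc[symmetric])
qed simp

lemma arg_min_imp_convex_subdiff:
  fixes f :: "'a::real_inner \<Rightarrow> ereal"
  assumes proper: "proper f"
    and min: "is_arg_min (\<lambda>w. f w - ereal (inner g w)) (\<lambda>_. True) x"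
  shows "g \<in> convex_subdiff f x"
proof -
  have le: "f x - ereal (inner g x) \<le> f w - ereal (inner g w)" for w
    using min by (simp add: is_arg_min_linorder)
  obtain w where w: "f w \<noteq> \<infinity>"
    using proper by (auto simp: proper_def)
  \<comment> \<open>Otherwise a point of the effective domain would have a smaller objective
    value.\<close>
  have "f x \<noteq> \<infinity>"
    using le[of w] w by (cases "f w") auto
  then obtain a where a: "f x = ereal a"
    using proper unfolding proper_def by (cases "f x") auto
  have "f x + ereal (inner g (y - x)) \<le> f y" for y
    using le[of y] a by (cases "f y") (auto simp: algebra_simps)
  then show ?thesis
    by (simp add: convex_subdiff_def a)
qed

lemma descent_quadratic_form:
  fixes d T :: "'a::real_inner" and M m K :: real
  assumes m: "0 < m" "m < M" and K: "0 < K" "K * (M - m) \<le> m * (2 * M - m)"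
    and mono: "(norm T)\<^sup>2 / K \<le> inner T d"
  shows "(M - m) / (2 * m\<^sup>2) * (norm (T - m *\<^sub>R d))\<^sup>2
    \<le> (M - m) / 2 * (norm d)\<^sup>2 + (norm T)\<^sup>2 / (2 * K)"
proof -
  have sq: "(norm (T - m *\<^sub>R d))\<^sup>2 = (norm T)\<^sup>2 - 2 * m * inner T d + m\<^sup>2 * (norm d)\<^sup>2"
    unfolding power2_norm_eq_inner by (simp add: algebra_simps inner_commute power2_eq_square)
  \<comment> \<open>The bound on \<open>K\<close> is exactly the comparison of the coefficients of
    \<open>(norm T)\<^sup>2\<close> that follows, cleared of denominators.\<close>
  have "(2 * m) * (K * (M - m)) \<le> (2 * m) * (m * (2 * M - m))"
    using m K by (intro mult_left_mono) auto
  then have "(M - m) / (2 * m\<^sup>2) \<le> (2 * M - m) / (2 * m * K)"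
    using m K by (simp add: field_simps power2_eq_square)
  then have "(M - m) / (2 * m\<^sup>2) * (norm T)\<^sup>2 \<le> (2 * M - m) / (2 * m * K) * (norm T)\<^sup>2"
    by (rule mult_right_mono) simp
  \<comment> \<open>The multiplier \<open>(M - m) / m\<close> of \<open>mono\<close> is chosen to
    cancel the cross term of the expanded square.\<close>
  also have "\<dots> = (norm T)\<^sup>2 / (2 * K) + (M - m) / m * ((norm T)\<^sup>2 / K)"
    using m K by (simp add: field_simps)
  also have "\<dots> \<le> (norm T)\<^sup>2 / (2 * K) + (M - m) / m * inner T d"
    using m mono by (intro add_left_mono mult_left_mono) auto
  finally have "(M - m) / (2 * m\<^sup>2) * (norm T)\<^sup>2 \<le> (norm T)\<^sup>2 / (2 * K) + (M - m) / m * inner T d" .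
  moreover have "(M - m) / (2 * m\<^sup>2) * (norm (T - m *\<^sub>R d))\<^sup>2
      = (M - m) / (2 * m\<^sup>2) * (norm T)\<^sup>2 - (M - m) / m * inner T d + (M - m) / 2 * (norm d)\<^sup>2"
    unfolding sq using m by (simp add: field_simps power2_eq_square)
  ultimately show ?thesis by linarith
qed

theorem lemma6:
  fixes f1 f2 :: "real ^ 'd \<Rightarrow> ereal"
    and \<mu>1 \<mu>2 :: real and L1 L2 :: ereal
    and x0 x1 x2 :: "real ^ 'd"
  assumes "dc_assumption \<mu>1 L1 \<mu>2 L2 f1 f2"
    and "\<mu>1 > - \<mu>2" and "- \<mu>2 > 0"
    and "\<mu>2 \<in> {- \<mu>1 <.. mu2_upper \<mu>1 L2}"
    and "x0 \<in> dom_subdiff \<mu>1 f1"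
    and "dca_step \<mu>2 f1 f2 x0 x1"
    and "dca_step \<mu>2 f1 f2 x1 x2"
  shows "dc_objective f1 f2 x0 - dc_objective f1 f2 x1
           \<ge> ereal (\<mu>1\<^sup>2 * (\<mu>1 + \<mu>2) / \<mu>2\<^sup>2 * (1 / 2) * (norm (x1 - x2))\<^sup>2)"
proof -
  define m where "m = - \<mu>2"
  have m: "0 < m" "m < \<mu>1" and \<mu>2: "\<mu>2 = - m" using assms(2,3) by (auto simp: m_def)
  have f1: "proper f1" "econvex (minus_quad \<mu>1 f1)"
    and f2: "f2 \<in> curv_class \<mu>2 L2" and \<mu>2_L2: "ereal \<mu>2 < L2"
    using assms(1) by (auto simp: dc_assumption_def curv_class_def)
  \<comment> \<open>For \<open>L2 = \<infinity>\<close> the upper bound is \<open>- \<mu>1\<close>,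
    so the interval for \<open>\<mu>2\<close> would be empty.\<close>
  obtain L where L: "L2 = ereal L"
    using assms(4) \<mu>2_L2 by (cases L2) (auto simp: mu2_upper_def)
  have "0 < L + \<mu>1" "\<mu>2 \<le> - L * \<mu>1 / (L + \<mu>1)"
    using assms(2,4) \<mu>2_L2 L by (auto simp: mu2_upper_def)
  then have "\<mu>2 * (L + \<mu>1) \<le> - L * \<mu>1"
    by (simp only: pos_le_divide_eq)
  then have K: "0 < L + m" "(L + m) * (\<mu>1 - m) \<le> m * (2 * \<mu>1 - m)"
    using \<mu>2_L2 L by (auto simp: m_def algebra_simps)

  define b where "b = (\<lambda>x. real_of_ereal (f2 x))"
  have f2_b: "f2 x = ereal (b x)" for x
  proof -
    have "f2 x < \<infinity>" "f2 x \<noteq> -\<infinity>"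
      using f2 by (auto simp: curv_class_def proper_def L)
    then show ?thesis by (cases "f2 x") (auto simp: b_def)
  qed
  \<comment> \<open>This is \<open>minus_quad \<mu>2 f2\<close> as a real function: its smoothness
    constant is \<open>L + m\<close>, and subgradients \<open>g\<close> of \<open>f2\<close> at
    \<open>x\<close> become \<open>g + m *\<^sub>R x\<close>.\<close>
  define h where "h = (\<lambda>x. b x + m / 2 * (norm x)\<^sup>2)"
  have "(\<lambda>x. (L + m) / 2 * (norm x)\<^sup>2 - h x) = (\<lambda>x. L / 2 * (norm x)\<^sup>2 - b x)"
    by (simp add: h_def fun_eq_iff algebra_simps add_divide_distrib)
  then have smooth: "convex_on UNIV (\<lambda>x. (L + m) / 2 * (norm x)\<^sup>2 - h x)"
    using f2 by (simp add: curv_class_def L b_def)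
  have subgrad: "h z \<ge> h x + inner (g + m *\<^sub>R x) (z - x)" if "g \<in> subdiff \<mu>2 f2 x" for g x z
    using that m by (auto simp: subdiff_def \<mu>2 convex_subdiff_def minus_quad_def f2_b h_def)

  obtain g0 where g0: "g0 \<in> subdiff \<mu>2 f2 x0" "g0 \<in> convex_subdiff f1 x1"
    using assms(6) arg_min_imp_convex_subdiff[OF f1(1)] by (auto simp: dca_step_def)
  obtain g1 where g1: "g1 \<in> subdiff \<mu>2 f2 x1" "g1 \<in> convex_subdiff f1 x2"
    using assms(7) arg_min_imp_convex_subdiff[OF f1(1)] by (auto simp: dca_step_def)
  have fin0: "f1 x0 < \<infinity>"
    using assms(5) m by (auto simp: dom_subdiff_def subdiff_def convex_subdiff_def)
  obtain a0 where a0: "f1 x0 = ereal a0"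
    using fin0 f1(1) by (cases "f1 x0") (auto simp: proper_def)
  obtain a1 where a1: "f1 x1 = ereal a1"
    using g0(2) f1(1) by (cases "f1 x1") (auto simp: proper_def convex_subdiff_def)

  define d where "d = x0 - x1"
  define T where "T = g0 - g1 + m *\<^sub>R d"
  have T: "(g0 + m *\<^sub>R x0) - (g1 + m *\<^sub>R x1) = T" "(g1 + m *\<^sub>R x1) - (g0 + m *\<^sub>R x0) = - T"
    by (simp_all add: T_def d_def algebra_simps)
  define s where "s = (norm T)\<^sup>2 / (2 * (L + m))"
  have h_le: "h x1 \<ge> h x0 - inner (g0 + m *\<^sub>R x0) d + s"
    using cocoercive_lower_bound[OF K(1) smooth subgrad[OF g0(1)] subgrad[OF g1(1)]]
    unfolding T by (simp add: s_def d_def inner_diff_right)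
  \<comment> \<open>With the roles swapped, the values of \<open>h\<close> cancel in the sum, which
    leaves cocoercivity.\<close>
  moreover have "h x0 \<ge> h x1 + inner (g1 + m *\<^sub>R x1) d + s"
    using cocoercive_lower_bound[OF K(1) smooth subgrad[OF g1(1)] subgrad[OF g0(1)]]
    unfolding T by (simp add: s_def d_def)
  moreover have "inner T d = inner (g0 + m *\<^sub>R x0) d - inner (g1 + m *\<^sub>R x1) d"
    unfolding T(1)[symmetric] by (rule inner_diff_left)
  moreover have "(norm T)\<^sup>2 / (L + m) = 2 * s"
    using K(1) by (simp add: s_def field_simps)
  ultimately have mono: "(norm T)\<^sup>2 / (L + m) \<le> inner T d"
    by linarith

  have "(\<mu>1 * norm (x1 - x2))\<^sup>2 \<le> (norm (g0 - g1))\<^sup>2"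
    using strong_monotonicity_norm[OF f1 g0(2) g1(2)] m by (intro power_mono) auto
  then have "(\<mu>1 - m) / (2 * m\<^sup>2) * (\<mu>1 * norm (x1 - x2))\<^sup>2
      \<le> (\<mu>1 - m) / (2 * m\<^sup>2) * (norm (g0 - g1))\<^sup>2"
    using m by (intro mult_left_mono) auto
  also have "\<dots> \<le> (\<mu>1 - m) / 2 * (norm d)\<^sup>2 + s"
    using descent_quadratic_form[OF m K mono] by (simp add: T_def s_def)
  also have "\<dots> \<le> (a0 - b x0) - (a1 - b x1)"
  proof -
    have "a0 \<ge> a1 + inner g0 d + \<mu>1 / 2 * (norm d)\<^sup>2"
      using strong_convexity_lower_bound[OF f1 g0(2) fin0] by (simp add: a0 a1 d_def)
    \<comment> \<open>Returning from \<open>h\<close> to \<open>b\<close>, the quadratic terms at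
      \<open>x0\<close> and \<open>x1\<close> combine into one in \<open>d\<close>.\<close>
    moreover have "b x1 \<ge> b x0 - inner g0 d - m / 2 * (norm d)\<^sup>2 + s"
      using h_le unfolding h_def d_def power2_norm_eq_inner
      by (simp add: algebra_simps inner_commute add_divide_distrib diff_divide_distrib)
    moreover have "(\<mu>1 - m) / 2 * (norm d)\<^sup>2 = \<mu>1 / 2 * (norm d)\<^sup>2 - m / 2 * (norm d)\<^sup>2"
      by (simp add: algebra_simps diff_divide_distrib)
    ultimately show ?thesis by linarith
  qed
  finally show ?thesis
    by (simp add: dc_objective_def a0 a1 f2_b \<mu>2 power_mult_distrib mult_ac)
qed

end
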